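(* For each $n$, let $A_n$ be drawn uniformly at random from $\{-1,1\}^n$, and let $\epsilon>0$ be real. Then, as $n\to\infty$, \[ \Pr\left[C_r(A_n)\le(1+\epsilon)\sqrt{2n\log\tbinom{n}{r-1}}\ \text{ for all integers } r \text{ satisfying } 2\le r\le n\right]\to 1. \]
   Context: For $A_n=(a_1,\dots,a_n)\in\{-1,1\}^n$ and $2\le r\le n$, the $r$-th order correlation measure of $A_n$ is \[ C_r(A_n)=\max_{0\le u_1<u_2<\cdots<u_r<n}\;\max_{1\le m\le n-u_r}\left|\sum_{j=1}^m a_{j+u_1}a_{j+u_2}\cdots a_{j+u_r}\right|, \] where $u_1,\dots,u_r$ and $m$ are integers. $\log$ is the natural logarithm. *)

theory Defs
  imports "HOL-Probability.Probability"
begin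

text \<open>
  An element of \<open>{-1,1}\<^sup>n\<close> is a function on the index set \<open>{1..n}\<close>;
  it is extensional, so that each sequence is represented by exactly one function.
\<close>

definition sign_seqs :: "nat \<Rightarrow> (nat \<Rightarrow> real) set" where
  "sign_seqs n = {1..n} \<rightarrow>\<^sub>E {-1, 1}"

text \<open>The tuples \<open>0 \<le> u\<^sub>1 < \<dots> < u\<^sub>r < n\<close>.\<close>

definition shift_tuples :: "nat \<Rightarrow> nat \<Rightarrow> (nat \<Rightarrow> nat) set" where
  "shift_tuples n r = {u \<in> {1..r} \<rightarrow>\<^sub>E {0..<n}. strict_mono_on {1..r} u}"

text \<open>
  Both maxima range over finite sets, which are nonempty for \<open>2 \<le> r \<le> n\<close>,
  the only range in which the definition is meant to be used.
\<close>

definition correlation_measure :: "nat \<Rightarrow> nat \<Rightarrow> (nat \<Rightarrow> real) \<Rightarrow> real" where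
  "correlation_measure n r a =
     (MAX u\<in>shift_tuples n r. MAX m\<in>{1..n - u r}.
        \<bar>\<Sum>j=1..m. \<Prod>i=1..r. a (j + u i)\<bar>)"

end

theory Submission
  imports Defs
begin

text \<open>
  The proof is a union bound over sub-Gaussian tails, arranged so that only about
  \<open>n choose (r - 1)\<close> many events carry weight.

  The sum over \<open>j \<in> {1..m}\<close> of \<open>a\<^bsub>j+u\<^sub>1\<^esub> \<dots> a\<^bsub>j+u\<^sub>r\<^esub>\<close> depends on the shift \<open>u\<^sub>1\<close> only through the
  window \<open>{u\<^sub>1<..u\<^sub>1+m}\<close> over which the products of the lags \<open>u\<^sub>i - u\<^sub>1\<close> are summed. So \<open>C\<^sub>r\<close>
  is a maximum over at most \<open>n choose (r - 1)\<close> sets of lags and, for each of them, over windows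
  inside \<open>{0<..n}\<close> (\<open>correlation_measure_le\<close>).

  For one set of lags and one window, the products are independent signs, since each new one
  involves a coordinate that does not occur before. Hence a window of length at most \<open>L\<close> has a sum
  exceeding \<open>b\<close> in absolute value with probability at most \<open>2 exp (- b\<^sup>2 / (2 L))\<close>
  (\<open>prob_window_sum_gt\<close>). Write \<open>C = n choose (r - 1)\<close> and \<open>\<Lambda> = sqrt (2 n ln C)\<close>. At level
  \<open>(1 + \<epsilon>) \<Lambda>\<close> this gives about \<open>C\<close> to the power \<open>- (1 + \<epsilon>)\<^sup>2\<close>, which pays for the \<open>C\<close> sets of
  lags, but for small \<open>r\<close> and \<open>\<epsilon>\<close> it does not also pay for the roughly \<open>n\<^sup>2\<close> windows. Therefore all
  windows are reduced to those with endpoints on a grid of about \<open>K\<close> points, \<open>K\<close> a constant, at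
  level \<open>(1 + \<epsilon>/2) \<Lambda>\<close>. The two leftover ends of a window have length at most \<open>2 n / K\<close>, and
  there the level \<open>(\<epsilon>/4) \<Lambda>\<close> is exceeded with a probability that is as high a power of \<open>1 / C\<close> as
  desired if \<open>K\<close> is large. As \<open>n \<le> C\<close>, that is enough to allow for all short windows at once
  (\<open>prob_exists_window_sum_gt\<close>).

  Altogether \<open>C\<^sub>r\<close> exceeds its bound with probability \<open>O (C powr (- \<epsilon>))\<close>, uniformly in \<open>r\<close>
  (\<open>prob_correlation_measure_gt\<close>), and the sum of these over \<open>r\<close> tends to \<open>0\<close> because
  \<open>n choose k\<close>, for \<open>0 < k < n\<close>, is at least \<open>n\<close> and grows at least geometrically with the distance of \<open>k\<close> from
  the ends of \<open>{0..n}\<close> (\<open>sum_choose_powr_tendsto_0\<close>).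
\<close>

section \<open>Sums of lagged products over a window\<close>

definition lag_prod :: "nat set \<Rightarrow> (nat \<Rightarrow> real) \<Rightarrow> nat \<Rightarrow> real" where
  "lag_prod W a x = (\<Prod>w\<in>W. a (x + w))"

definition window_sum :: "nat set \<Rightarrow> nat \<Rightarrow> nat \<Rightarrow> (nat \<Rightarrow> real) \<Rightarrow> real" where
  "window_sum W k l a = (\<Sum>x\<in>{k<..l}. lag_prod W a x)"

text \<open>
  The sets of differences \<open>u\<^sub>i - u\<^sub>1\<close>, where the difference \<open>0\<close> is always present.
  As \<open>i \<mapsto> u\<^sub>i\<close> is strictly increasing, the set determines the differences in order.
\<close>

definition lag_sets :: "nat \<Rightarrow> nat \<Rightarrow> nat set set" where
  "lag_sets n r = insert 0 ` {V. V \<subseteq> {1..<n} \<and> card V = r - 1}"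

lemma lag_setsD:
  assumes "W \<in> lag_sets n r"
  shows "finite W" "W \<noteq> {}"
  using assms by (auto simp: lag_sets_def intro: finite_subset[OF _ finite_atLeastLessThan])

lemma finite_lag_sets: "finite (lag_sets n r)"
  unfolding lag_sets_def by simp

lemma card_lag_sets: "card (lag_sets n r) \<le> n choose (r - 1)"
proof -
  have "card (lag_sets n r) \<le> card {V. V \<subseteq> {1..<n} \<and> card V = r - 1}"
    unfolding lag_sets_def
    by (intro card_image_le) simp
  also have "\<dots> = (n - 1) choose (r - 1)"
    by (simp add: n_subsets)
  also have "\<dots> \<le> n choose (r - 1)"
    by (intro binomial_right_mono) simp
  finally show ?thesis .
qed

lemma window_sum_split:
  assumes "k \<le> m" "m \<le> l"
  shows "window_sum W k l a = window_sum W k m a + window_sum W m l a"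
proof -
  have "{k<..l} = {k<..m} \<union> {m<..l}" using assms by auto
  then show ?thesis
    unfolding window_sum_def by (simp add: sum.union_disjoint disjoint_iff)
qed

text \<open>
  The shift \<open>u\<^sub>1\<close> is absorbed into the window \<open>{u\<^sub>1<..u\<^sub>1+m}\<close>, and \<open>m \<le> n - u\<^sub>r\<close> becomes the
  condition that the largest lag, applied at the right end of the window, stays inside \<open>{1..n}\<close>.
  Counting lag sets instead of tuples replaces \<open>n choose r\<close>, which for small \<open>r\<close> is too many events
  for the union bound, by \<open>n choose (r - 1)\<close>.
\<close>

lemma correlation_measure_le:
  assumes r: "2 \<le> r" "r \<le> n"
    and bound: "\<And>W k l. W \<in> lag_sets n r \<Longrightarrow> k \<le> l \<Longrightarrow> l + Max W \<le> n
      \<Longrightarrow> \<bar>window_sum W k l a\<bar> \<le> b"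
  shows "correlation_measure n r a \<le> b"
proof -
  have fin: "finite (shift_tuples n r)"
    unfolding shift_tuples_def
    by (rule finite_subset[of _ "{1..r} \<rightarrow>\<^sub>E {0..<n}"]) (auto intro: finite_PiE)
  have "(\<lambda>i\<in>{1..r}. i - 1) \<in> shift_tuples n r"
    unfolding shift_tuples_def using r by (auto simp: strict_mono_on_def)
  then have ne: "shift_tuples n r \<noteq> {}" by blast
  have "\<bar>\<Sum>j=1..m. \<Prod>i=1..r. a (j + u i)\<bar> \<le> b"
    if u: "u \<in> shift_tuples n r" and m: "m \<in> {1..n - u r}" for u m
  proof -
    have mono: "strict_mono_on {1..r} u" and range: "\<And>i. i \<in> {1..r} \<Longrightarrow> u i < n"
      using u unfolding shift_tuples_def by auto
    have less: "u i < u j" if "1 \<le> i" "i < j" "j \<le> r" for i j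
      using mono that by (auto simp: strict_mono_on_def)
    have le: "u i \<le> u j" if "1 \<le> i" "i \<le> j" "j \<le> r" for i j
      using less[of i j] that by (cases "i = j") auto
    define W where "W = (\<lambda>i. u i - u 1) ` {1..r}"
    have inj: "inj_on (\<lambda>i. u i - u 1) {1..r}"
    proof (rule inj_onI)
      fix i j assume "i \<in> {1..r}" "j \<in> {1..r}" "u i - u 1 = u j - u 1"
      with le[of 1 i] le[of 1 j] have "u i = u j" by auto
      with less[of i j] less[of j i] \<open>i \<in> {1..r}\<close> \<open>j \<in> {1..r}\<close> show "i = j"
        by (metis atLeastAtMost_iff less_irrefl linorder_neqE_nat)
    qed
    have zero: "0 \<in> W"
      unfolding W_def using r by (intro rev_image_eqI[of 1]) auto
    moreover have "card W = r"
      unfolding W_def using card_image[OF inj] by simp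
    then have "card (W - {0}) = r - 1"
      using zero by simp
    moreover have "W - {0} \<subseteq> {1..<n}"
    proof
      fix w assume "w \<in> W - {0}"
      then obtain i where "i \<in> {1..r}" "w = u i - u 1" "w \<noteq> 0" unfolding W_def by blast
      with range[of i] show "w \<in> {1..<n}" by auto
    qed
    ultimately have W: "W \<in> lag_sets n r"
      unfolding lag_sets_def using insert_Diff[OF zero] by blast
    have "Max W = u r - u 1"
    proof (rule Max_eqI)
      show "u r - u 1 \<in> W" unfolding W_def using r by (intro imageI) auto
      show "finite W" by (simp add: W_def)
      fix w assume "w \<in> W"
      then obtain i where i: "i \<in> {1..r}" "w = u i - u 1" unfolding W_def by blast
      then have "u i \<le> u r" by (intro le) auto
      then show "w \<le> u r - u 1" using i(2) by (simp add: diff_le_mono)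
    qed
    then have fits: "(u 1 + m) + Max W \<le> n"
      using m le[of 1 r] r range[of r] by auto
    have "lag_prod W a (j + u 1) = (\<Prod>i=1..r. a (j + u i))" for j
    proof -
      have "lag_prod W a (j + u 1) = (\<Prod>i=1..r. a (j + u 1 + (u i - u 1)))"
        unfolding lag_prod_def W_def by (subst prod.reindex[OF inj]) simp
      also have "\<dots> = (\<Prod>i=1..r. a (j + u i))"
      proof (rule prod.cong[OF refl])
        fix i assume "i \<in> {1..r}"
        then have "u 1 \<le> u i" by (intro le) auto
        then show "a (j + u 1 + (u i - u 1)) = a (j + u i)" by simp
      qed
      finally show ?thesis .
    qed
    then have "(\<Sum>j=1..m. \<Prod>i=1..r. a (j + u i)) = (\<Sum>j=1..m. lag_prod W a (j + u 1))"
      by simp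
    also have "\<dots> = window_sum W (u 1) (u 1 + m) a"
      unfolding window_sum_def
      by (rule sum.reindex_bij_witness[of _ "\<lambda>x. x - u 1" "\<lambda>j. j + u 1"]) auto
    finally show ?thesis using bound[OF W _ fits] by simp
  qed
  moreover have "{1..n - u r} \<noteq> {}" if "u \<in> shift_tuples n r" for u
  proof -
    have "u r < n" using that r unfolding shift_tuples_def by auto
    then show ?thesis by auto
  qed
  ultimately show ?thesis
    unfolding correlation_measure_def using fin ne by (simp add: Max_le_iff)
qed

section \<open>A sub-Gaussian tail bound\<close>

text \<open>
  Hoeffding's lemma for a fair sign, with values in an interval of length \<open>2\<close>: the auxiliary
  inequality behind that lemma is used at \<open>p = 1/2\<close> and \<open>h = 2 t\<close>.
\<close>

lemma cosh_le_exp_half_square: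
  fixes t :: real
  assumes "0 \<le> t"
  shows "cosh t \<le> exp (t\<^sup>2 / 2)"
proof -
  have "cosh t = exp (- t) * (1 + 1 / 2 * (exp (2 * t) - 1))"
    by (simp add: cosh_def field_simps flip: exp_add)
  also have "\<dots> = exp (- (2 * t) * (1 / 2) + ln (1 + 1 / 2 * (exp (2 * t) - 1)))"
    using add_pos_pos[of 1 "exp (2 * t)"] by (subst exp_add, subst exp_ln) (auto simp: field_simps)
  also have "\<dots> \<le> exp ((2 * t)\<^sup>2 / 8)"
    using Hoeffdings_lemma_aux[of "2 * t" "1 / 2"] assms by simp
  finally show ?thesis by (simp add: power2_eq_square)
qed

lemma finite_sign_seqs: "finite (sign_seqs n)"
  and sign_seqs_nonempty: "sign_seqs n \<noteq> {}"
  unfolding sign_seqs_def by (auto intro!: finite_PiE simp: PiE_eq_empty_iff)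

lemma sum_sign_seqs_flip:
  assumes "p \<in> {1..n}"
  shows "(\<Sum>a\<in>sign_seqs n. f (a(p := - a p))) = (\<Sum>a\<in>sign_seqs n. f a)"
proof -
  have "a(p := - a p) \<in> sign_seqs n" if "a \<in> sign_seqs n" for a
  proof -
    have "- a p \<in> {-1, 1}" using that assms unfolding sign_seqs_def by force
    then show ?thesis
      using that assms PiE_fun_upd[of "- a p" "\<lambda>_. {-1, 1}" p a "{1..n}"]
      unfolding sign_seqs_def by (simp add: insert_absorb)
  qed
  then show ?thesis
    by (intro sum.reindex_bij_witness[of _ "\<lambda>a. a(p := - a p)" "\<lambda>a. a(p := - a p)"]) auto
qed

text \<open>
  The moment generating function of a window sum is that of independent fair signs. When the window
  is extended by the point \<open>l + 1\<close>, the new product contains the coordinate \<open>p = l + 1 + Max W\<close>,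
  which lies beyond all coordinates in the old sum. Negating it preserves the uniform distribution
  and the old sum, and reverses the new product; averaging over both signs produces a factor
  \<open>cosh t\<close>.
\<close>

lemma sum_exp_window_sum:
  assumes W: "finite W" "W \<noteq> {}" and "l + Max W \<le> n" "k \<le> l"
  shows "(\<Sum>a\<in>sign_seqs n. exp (t * window_sum W k l a))
    = cosh t ^ (l - k) * card (sign_seqs n)"
  using \<open>k \<le> l\<close> \<open>l + Max W \<le> n\<close>
proof (induction l rule: dec_induct)
  case base
  show ?case by (simp add: window_sum_def)
next
  case (step l)
  \<comment> \<open>the last coordinate of the new product, and of no product before it\<close>
  define p where "p = Suc l + Max W"
  have p: "p \<in> {1..n}" using step.prems by (simp add: p_def)
  let ?S = "window_sum W k l" and ?X = "\<lambda>a. lag_prod W a (Suc l)"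
  have Suc: "window_sum W k (Suc l) a = ?S a + ?X a" for a
    using step.hyps window_sum_split[of k l "Suc l" W a]
    by (simp add: window_sum_def flip: atLeastSucAtMost_greaterThanAtMost)
  have S: "?S (a(p := - a p)) = ?S a" for a
    unfolding window_sum_def lag_prod_def
  proof (intro sum.cong prod.cong refl)
    fix x w assume "x \<in> {k<..l}" "w \<in> W"
    then have "x + w < p" using Max_ge[OF W(1), of w] by (auto simp: p_def)
    then show "(a(p := - a p)) (x + w) = a (x + w)" by simp
  qed
  have X: "?X (a(p := - a p)) = - ?X a" for a
  proof -
    have "Max W \<in> W" using W by (rule Max_in)
    moreover have "(\<Prod>w\<in>W - {Max W}. (a(p := - a p)) (Suc l + w)) = (\<Prod>w\<in>W - {Max W}. a (Suc l + w))"
      by (intro prod.cong) (auto simp: p_def)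
    ultimately show ?thesis
      unfolding lag_prod_def using W(1)
      by (simp only: prod.remove[of W "Max W"]) (simp add: p_def)
  qed
  have cosh_X: "cosh (t * ?X a) = cosh t" if "a \<in> sign_seqs n" for a
  proof -
    have "\<bar>?X a\<bar> = (\<Prod>w\<in>W. \<bar>a (Suc l + w)\<bar>)"
      unfolding lag_prod_def by (rule abs_prod)
    also have "\<dots> = 1"
    proof (intro prod.neutral ballI)
      fix w assume "w \<in> W"
      then have "Suc l + w \<in> {1..n}" using Max_ge[OF W(1), of w] step.prems by auto
      then have "a (Suc l + w) \<in> {-1, 1}" using that unfolding sign_seqs_def by blast
      then show "\<bar>a (Suc l + w)\<bar> = 1" by auto
    qed
    finally have "?X a = 1 \<or> ?X a = - 1" by linarith
    then show ?thesis by auto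
  qed
  have "2 * (\<Sum>a\<in>sign_seqs n. exp (t * window_sum W k (Suc l) a))
    = (\<Sum>a\<in>sign_seqs n. exp (t * (?S a + ?X a))) + (\<Sum>a\<in>sign_seqs n. exp (t * (?S a - ?X a)))"
    using sum_sign_seqs_flip[OF p, of "\<lambda>a. exp (t * (?S a + ?X a))"] by (simp add: Suc S X)
  also have "\<dots> = (\<Sum>a\<in>sign_seqs n. 2 * (exp (t * ?S a) * cosh (t * ?X a)))"
    unfolding sum.distrib[symmetric]
    by (intro sum.cong refl) (simp add: cosh_def field_simps exp_add exp_diff exp_minus)
  also have "\<dots> = 2 * (cosh t * (\<Sum>a\<in>sign_seqs n. exp (t * ?S a)))"
    by (simp add: cosh_X sum_distrib_left mult_ac)
  finally show ?case
    using step by (simp add: Suc_diff_le)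
qed

text \<open>
  Markov's inequality for \<open>exp (t S) + exp (- t S)\<close>, with the optimal \<open>t = b / L\<close>. The bound is
  stated for any \<open>L\<close> above the length of the window, so that it is uniform over windows.
\<close>

lemma prob_window_sum_gt:
  assumes W: "finite W" "W \<noteq> {}" and fits: "l + Max W \<le> n" "k \<le> l"
    and L: "real (l - k) \<le> L" "0 < L" and "0 \<le> b"
  shows "measure_pmf.prob (pmf_of_set (sign_seqs n)) {a. b < \<bar>window_sum W k l a\<bar>}
    \<le> 2 * exp (- b\<^sup>2 / (2 * L))"
proof -
  define t where "t = b / L"
  have t: "0 \<le> t" using assms by (simp add: t_def)
  let ?B = "{a \<in> sign_seqs n. b < \<bar>window_sum W k l a\<bar>}"
  have "card ?B * exp (t * b) = (\<Sum>a\<in>?B. exp (t * b))"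
    by simp
  also have "\<dots> \<le> (\<Sum>a\<in>?B. exp (t * window_sum W k l a) + exp (- t * window_sum W k l a))"
  proof (rule sum_mono)
    fix a assume "a \<in> ?B"
    then have "t * b \<le> \<bar>t * window_sum W k l a\<bar>"
      using t by (auto simp: abs_mult intro!: mult_left_mono)
    then have "exp (t * b) \<le> exp \<bar>t * window_sum W k l a\<bar>" by simp
    also have "\<dots> \<le> exp (t * window_sum W k l a) + exp (- t * window_sum W k l a)"
      by (simp add: abs_if)
    finally show "exp (t * b) \<le> \<dots>" .
  qed
  also have "\<dots> \<le> (\<Sum>a\<in>sign_seqs n. exp (t * window_sum W k l a) + exp (- t * window_sum W k l a))"
    by (rule sum_mono2) (auto simp: finite_sign_seqs add_nonneg_nonneg)
  also have "\<dots> = 2 * cosh t ^ (l - k) * card (sign_seqs n)"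
    using sum_exp_window_sum[OF W fits, of t] sum_exp_window_sum[OF W fits, of "- t"]
    by (simp add: sum.distrib)
  also have "\<dots> \<le> 2 * exp (L * (t\<^sup>2 / 2)) * card (sign_seqs n)"
  proof -
    have "cosh t ^ (l - k) \<le> exp (t\<^sup>2 / 2) ^ (l - k)"
      by (intro power_mono cosh_le_exp_half_square t) simp
    also have "\<dots> \<le> exp (L * (t\<^sup>2 / 2))"
      using L by (simp add: mult_right_mono flip: exp_of_nat_mult)
    finally show ?thesis by (simp add: mult_right_mono)
  qed
  finally have "card ?B / card (sign_seqs n) \<le> 2 * exp (L * (t\<^sup>2 / 2)) / exp (t * b)"
    using sign_seqs_nonempty[of n] finite_sign_seqs[of n]
    by (simp add: field_simps card_gt_0_iff)
  also have "\<dots> = 2 * exp (L * (t\<^sup>2 / 2) - t * b)"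
    by (simp add: exp_diff)
  also have "L * (t\<^sup>2 / 2) - t * b = - b\<^sup>2 / (2 * L)"
    using L by (simp add: t_def power2_eq_square field_simps)
  finally show ?thesis
    by (simp add: measure_pmf_of_set sign_seqs_nonempty finite_sign_seqs Collect_conj_eq Int_commute)
qed

section \<open>Controlling all windows by a coarse grid\<close>

text \<open>
  Both endpoints are rounded down to multiples of \<open>s\<close>. Rounding down, unlike rounding up, never
  leaves the range in which window sums are controlled; the price is that the left end piece
  enters with a minus sign.
\<close>

lemma window_sum_le_of_grid:
  assumes "0 < s" "k \<le> l" "l + p \<le> n"
    and grid: "\<And>k l. k \<le> l \<Longrightarrow> l + p \<le> n \<Longrightarrow> s dvd k \<Longrightarrow> s dvd l
      \<Longrightarrow> \<bar>window_sum W k l a\<bar> \<le> b"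
    and short: "\<And>k l. k \<le> l \<Longrightarrow> l + p \<le> n \<Longrightarrow> l - k \<le> s \<Longrightarrow> \<bar>window_sum W k l a\<bar> \<le> c"
  shows "\<bar>window_sum W k l a\<bar> \<le> b + 2 * c"
proof -
  define k' l' where "k' = k div s * s" and "l' = l div s * s"
  have order: "k' \<le> k" "k' \<le> l'" "l' \<le> l"
    using \<open>k \<le> l\<close> by (auto simp: k'_def l'_def div_le_mono)
  have "k - k' \<le> s" "l - l' \<le> s"
    using \<open>0 < s\<close> by (simp_all add: k'_def l'_def minus_div_mult_eq_mod less_imp_le)
  then have "\<bar>window_sum W k' k a\<bar> \<le> c" "\<bar>window_sum W l' l a\<bar> \<le> c" "\<bar>window_sum W k' l' a\<bar> \<le> b"
    using order assms(2,3) by (auto intro!: short grid) (auto simp: k'_def l'_def)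
  moreover have "window_sum W k' k a + window_sum W k l a = window_sum W k' l' a + window_sum W l' l a"
    using window_sum_split[of k' k l W a] window_sum_split[of k' l' l W a] order assms(2) by simp
  ultimately show ?thesis by linarith
qed

text \<open>
  With step \<open>s = n div K + 1\<close> there are at most \<open>K + 1\<close> grid points, while \<open>s \<le> 2 n / K\<close>
  bounds the length of the end pieces. The polynomial factor \<open>(n + 1)\<^sup>2\<close> appears only with the tail of
  these short windows, whose exponent can be made large through \<open>K\<close>.
\<close>

lemma prob_exists_window_sum_gt:
  assumes W: "finite W" "W \<noteq> {}" and "0 < K" "K \<le> n" "0 \<le> b" "0 \<le> c"
  shows "measure_pmf.prob (pmf_of_set (sign_seqs n))
      {a. \<exists>k l. k \<le> l \<and> l + Max W \<le> n \<and> b + 2 * c < \<bar>window_sum W k l a\<bar>}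
    \<le> 2 * (real K + 1)\<^sup>2 * exp (- b\<^sup>2 / (2 * real n))
      + 2 * (real n + 1)\<^sup>2 * exp (- c\<^sup>2 * real K / (4 * real n))"
proof -
  define P where "P = measure_pmf.prob (pmf_of_set (sign_seqs n))"
  define s where "s = n div K + 1"
  define G where "G = {x \<in> {..n}. s dvd x}"
  let ?pairs = "\<lambda>X. {(k, l). k \<in> X \<and> l \<in> X \<and> k \<le> l \<and> l + Max W \<le> n}"
  define long where "long = ?pairs G"
  define short where "short = {(k, l) \<in> ?pairs {..n}. l - k \<le> s}"
  let ?bad = "\<lambda>c (k, l). {a. c < \<bar>window_sum W k l a\<bar>}"
  have s: "real s \<le> 2 * real n / real K" "0 < s"
  proof -
    have "real (n div K) \<le> real n / real K"
      by (rule of_nat_div_le_of_nat)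
    moreover have "1 \<le> real n / real K" using \<open>0 < K\<close> \<open>K \<le> n\<close> by simp
    ultimately show "real s \<le> 2 * real n / real K" by (simp add: s_def)
  qed (simp add: s_def)
  have finite_G: "finite G" by (simp add: G_def)
  have card_G: "card G \<le> K + 1"
  proof -
    have "x div s \<le> K" if "x \<le> n" for x
    proof -
      have "n < K * s"
        using \<open>0 < K\<close> by (simp add: s_def) (metis dividend_less_times_div)
      then have "x < K * s" using that by simp
      then show ?thesis by (simp add: less_mult_imp_div_less less_imp_le)
    qed
    then have "G \<subseteq> (\<lambda>i. i * s) ` {..K}"
      by (force simp: G_def dvd_div_mult_self intro: rev_image_eqI[of "_ div s"])
    then have "card G \<le> card {..K}"
      by (rule surj_card_le[rotated]) simp
    then show ?thesis by simp
  qed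
  have card_pairs: "finite (?pairs X)" "card (?pairs X) \<le> card X * card X" if "finite X" for X
  proof -
    have "?pairs X \<subseteq> X \<times> X" by auto
    then show "finite (?pairs X)" "card (?pairs X) \<le> card X * card X"
      using that card_mono[of "X \<times> X" "?pairs X"] finite_subset[of "?pairs X" "X \<times> X"]
      by (auto simp: card_cartesian_product)
  qed
  have long: "finite long" "real (card long) \<le> (real K + 1)\<^sup>2"
  proof -
    show "finite long" unfolding long_def by (rule card_pairs(1)[OF finite_G])
    have "card long \<le> (K + 1) * (K + 1)"
      unfolding long_def using card_pairs(2)[OF finite_G] mult_le_mono[OF card_G card_G] by simp
    then have "real (card long) \<le> real ((K + 1) * (K + 1))" by (rule of_nat_mono)
    then show "real (card long) \<le> (real K + 1)\<^sup>2"
      by (simp add: power2_eq_square algebra_simps)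
  qed
  have short: "finite short" "real (card short) \<le> (real n + 1)\<^sup>2"
  proof -
    have sub: "short \<subseteq> ?pairs {..n}" by (auto simp: short_def)
    then show "finite short" using card_pairs(1)[of "{..n}"] finite_subset by blast
    have "card short \<le> (n + 1) * (n + 1)"
      using card_mono[OF card_pairs(1) sub] card_pairs(2)[of "{..n}"] by simp
    then have "real (card short) \<le> real ((n + 1) * (n + 1))" by (rule of_nat_mono)
    then show "real (card short) \<le> (real n + 1)\<^sup>2"
      by (simp add: power2_eq_square algebra_simps)
  qed
  have cover: "{a. \<exists>k l. k \<le> l \<and> l + Max W \<le> n \<and> b + 2 * c < \<bar>window_sum W k l a\<bar>}
    \<subseteq> (\<Union>q\<in>long. ?bad b q) \<union> (\<Union>q\<in>short. ?bad c q)" (is "?A \<subseteq> ?B")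
  proof
    fix a assume "a \<in> ?A"
    then obtain k l where kl: "k \<le> l" "l + Max W \<le> n" "b + 2 * c < \<bar>window_sum W k l a\<bar>"
      by blast
    show "a \<in> ?B"
    proof (rule ccontr)
      assume *: "a \<notin> ?B"
      have "\<bar>window_sum W k l a\<bar> \<le> b + 2 * c"
      proof (rule window_sum_le_of_grid[OF s(2) kl(1,2)])
        fix k l assume kl: "k \<le> l" "l + Max W \<le> n"
        show "\<bar>window_sum W k l a\<bar> \<le> b" if "s dvd k" "s dvd l"
        proof -
          have "(k, l) \<in> long" using kl that by (auto simp: long_def G_def)
          with * show ?thesis by force
        qed
        show "\<bar>window_sum W k l a\<bar> \<le> c" if "l - k \<le> s"
        proof -
          have "(k, l) \<in> short" using kl that by (auto simp: short_def)
          with * show ?thesis by force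
        qed
      qed
      with kl show False by simp
    qed
  qed
  have n: "0 < real n" using assms by simp
  have long_prob: "P (?bad b q) \<le> 2 * exp (- b\<^sup>2 / (2 * real n))" if "q \<in> long" for q
    using that n prob_window_sum_gt[OF W, of "snd q" n "fst q" "real n" b] \<open>0 \<le> b\<close>
    by (auto simp: long_def P_def)
  have short_prob: "P (?bad c q) \<le> 2 * exp (- c\<^sup>2 * real K / (4 * real n))" if mem: "q \<in> short" for q
  proof -
    obtain k l where q: "q = (k, l)" "k \<le> l" "l + Max W \<le> n" "l - k \<le> s"
      using mem by (cases q) (auto simp: short_def)
    have "real (l - k) \<le> 2 * real n / real K"
      using of_nat_mono[OF q(4)] s(1) by (rule order_trans)
    then have "P (?bad c q) \<le> 2 * exp (- c\<^sup>2 / (2 * (2 * real n / real K)))"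
      unfolding P_def using prob_window_sum_gt[OF W q(3,2), of "2 * real n / real K" c] n \<open>0 < K\<close> \<open>0 \<le> c\<close>
      by (simp add: q(1))
    then show ?thesis by simp
  qed
  have union: "P (\<Union>q\<in>I. F q) \<le> (\<Sum>q\<in>I. P (F q))" if "finite I"
    for I :: "(nat \<times> nat) set" and F
    unfolding P_def using that by (intro measure_UNION_le) auto
  have "P ?A \<le> P ?B"
    unfolding P_def by (rule measure_pmf.finite_measure_mono[OF cover]) simp
  also have "\<dots> \<le> P (\<Union>q\<in>long. ?bad b q) + P (\<Union>q\<in>short. ?bad c q)"
    unfolding P_def by (intro measure_Un_le) auto
  also have "\<dots> \<le> (\<Sum>q\<in>long. P (?bad b q)) + (\<Sum>q\<in>short. P (?bad c q))"
    by (intro add_mono union long short)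
  also have "\<dots> \<le> card long * (2 * exp (- b\<^sup>2 / (2 * real n)))
      + card short * (2 * exp (- c\<^sup>2 * real K / (4 * real n)))"
    by (intro add_mono sum_bounded_above long_prob short_prob)
  also have "\<dots> \<le> (real K + 1)\<^sup>2 * (2 * exp (- b\<^sup>2 / (2 * real n)))
      + (real n + 1)\<^sup>2 * (2 * exp (- c\<^sup>2 * real K / (4 * real n)))"
    by (intro add_mono mult_right_mono long short) auto
  finally show ?thesis by (simp add: P_def mult_ac)
qed

section \<open>Binomial coefficients\<close>

lemma le_choose:
  assumes "1 \<le> k" "k < n"
  shows "n \<le> n choose k"
  using assms
proof (induction n arbitrary: k)
  case (Suc n)
  then obtain j where j: "k = Suc j" by (cases k) auto
  show ?case
  proof (cases "k = n")
    case False
    then have "n \<le> n choose k" using Suc by simp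
    moreover have "0 < n choose j" using Suc.prems j by simp
    ultimately show ?thesis unfolding j binomial_Suc_Suc by linarith
  qed simp
qed simp

lemma two_power_le_choose:
  assumes "2 * k \<le> n"
  shows "2 ^ k \<le> real (n choose k)"
proof (cases "k = 0")
  case False
  then have "2 \<le> real n / real k" using assms by (simp add: field_simps)
  then have "2 ^ k \<le> (real n / real k) ^ k" by (intro power_mono) auto
  also have "\<dots> \<le> real (n choose k)"
    using assms by (intro binomial_ge_n_over_k_pow_k) simp
  finally show ?thesis .
qed simp

text \<open>
  For \<open>0 < k < n\<close> the binomial coefficient is at least \<open>n\<close> and also at least \<open>2 ^ min k (n - k)\<close>. One half of the
  exponent is spent on each bound: the first makes the sum tend to \<open>0\<close>, the second makes it
  comparable with a geometric series.
\<close>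

lemma sum_choose_powr_tendsto_0:
  fixes \<epsilon> :: real
  assumes "0 < \<epsilon>"
  shows "(\<lambda>n. \<Sum>k\<in>{1..<n}. real (n choose k) powr (- \<epsilon>)) \<longlonglongrightarrow> 0"
proof -
  define q :: real where "q = 2 powr (- (\<epsilon> / 2))"
  have q: "0 < q" "q < 1"
    using assms powr_less_mono[of "- (\<epsilon> / 2)" 0 2] by (auto simp: q_def)
  have term_le: "real (n choose k) powr (- \<epsilon>) \<le> real n powr (- (\<epsilon> / 2)) * (q ^ k + q ^ (n - k))"
    if k: "k \<in> {1..<n}" for n k
  proof -
    let ?C = "real (n choose k)"
    have half: "?C powr (- (\<epsilon> / 2)) \<le> q ^ i" if "2 ^ i \<le> ?C" for i
    proof -
      have "?C powr (- (\<epsilon> / 2)) \<le> (2 ^ i) powr (- (\<epsilon> / 2))"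
        using that assms by (intro powr_mono2') auto
      also have "\<dots> = q ^ i"
        by (simp add: q_def powr_powr mult.commute flip: powr_realpow)
      finally show ?thesis .
    qed
    have "2 ^ k \<le> ?C \<or> 2 ^ (n - k) \<le> ?C"
      using two_power_le_choose[of k n] two_power_le_choose[of "n - k" n] k
        binomial_symmetric[of k n] by (cases "2 * k \<le> n") auto
    then have "?C powr (- (\<epsilon> / 2)) \<le> q ^ k + q ^ (n - k)"
      using half[of k] half[of "n - k"] q zero_le_power[of q k] zero_le_power[of q "n - k"] by linarith
    moreover have "?C powr (- (\<epsilon> / 2)) \<le> real n powr (- (\<epsilon> / 2))"
      using le_choose[of k n] k assms by (intro powr_mono2') auto
    ultimately have "?C powr (- (\<epsilon> / 2)) * ?C powr (- (\<epsilon> / 2))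
        \<le> real n powr (- (\<epsilon> / 2)) * (q ^ k + q ^ (n - k))"
      by (intro mult_mono) auto
    then show ?thesis by (simp flip: powr_add)
  qed
  have geometric: "(\<Sum>k\<in>I. q ^ k) \<le> 1 / (1 - q)" if "finite I" for I
    using sum_le_suminf[OF summable_geometric that, of q] q suminf_geometric[of q] by simp
  have bound: "(\<Sum>k\<in>{1..<n}. real (n choose k) powr (- \<epsilon>))
      \<le> real n powr (- (\<epsilon> / 2)) * (2 / (1 - q))" for n
  proof -
    have "(\<Sum>k\<in>{1..<n}. q ^ (n - k)) = (\<Sum>k\<in>{1..<n}. q ^ k)"
      by (rule sum.reindex_bij_witness[of _ "\<lambda>k. n - k" "\<lambda>k. n - k"]) auto
    then have "(\<Sum>k\<in>{1..<n}. q ^ k + q ^ (n - k)) \<le> 2 / (1 - q)"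
      using geometric[of "{1..<n}"] by (simp add: sum.distrib)
    then have "real n powr (- (\<epsilon> / 2)) * (\<Sum>k\<in>{1..<n}. q ^ k + q ^ (n - k))
        \<le> real n powr (- (\<epsilon> / 2)) * (2 / (1 - q))"
      by (rule mult_left_mono) simp
    moreover have "(\<Sum>k\<in>{1..<n}. real (n choose k) powr (- \<epsilon>))
        \<le> real n powr (- (\<epsilon> / 2)) * (\<Sum>k\<in>{1..<n}. q ^ k + q ^ (n - k))"
      unfolding sum_distrib_left by (intro sum_mono term_le)
    ultimately show ?thesis by linarith
  qed
  have "(\<lambda>n. real n powr (- (\<epsilon> / 2))) \<longlonglongrightarrow> 0"
    using assms by (intro tendsto_neg_powr filterlim_real_sequentially) simp
  then have "(\<lambda>n. real n powr (- (\<epsilon> / 2)) * (2 / (1 - q))) \<longlonglongrightarrow> 0"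
    by (rule tendsto_mult_left_zero)
  then show ?thesis
    by (rule tendsto_sandwich[OF always_eventually always_eventually tendsto_const, rotated 2])
       (intro allI sum_nonneg bound powr_ge_zero)+
qed

section \<open>The union bound\<close>

text \<open>
  The level splits as \<open>1 + \<epsilon> = (1 + \<epsilon>/2) + 2 (\<epsilon>/4)\<close>, one part for the grid windows and two for the
  end pieces. Since \<open>(1 + \<epsilon>/2)\<^sup>2 \<ge> 1 + \<epsilon>\<close>, a grid window fails with probability at most
  \<open>2 C powr (- (1 + \<epsilon>))\<close>. A short window fails with exponent \<open>\<epsilon>\<^sup>2 K / 32\<close>, and the
  hypothesis on \<open>K\<close> makes this at least \<open>3 + \<epsilon>\<close>: two powers of \<open>C\<close> cancel the number of short windows,
  and \<open>1 + \<epsilon>\<close> remains. One more power of \<open>C\<close> is lost to the number of lag sets.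
\<close>

lemma prob_correlation_measure_gt:
  fixes \<epsilon> :: real
  assumes "0 < \<epsilon>" "2 \<le> r" "r \<le> n" "K \<le> n" "32 * (3 + \<epsilon>) / \<epsilon>\<^sup>2 \<le> real K"
  shows "measure_pmf.prob (pmf_of_set (sign_seqs n))
      {a. (1 + \<epsilon>) * sqrt (2 * real n * ln (real (n choose (r - 1)))) < correlation_measure n r a}
    \<le> (2 * (real K + 1)\<^sup>2 + 8) * real (n choose (r - 1)) powr (- \<epsilon>)"
proof -
  define P where "P = measure_pmf.prob (pmf_of_set (sign_seqs n))"
  define C where "C = real (n choose (r - 1))"
  define \<Lambda> where "\<Lambda> = sqrt (2 * real n * ln C)"
  define b c where "b = (1 + \<epsilon> / 2) * \<Lambda>" and "c = \<epsilon> / 4 * \<Lambda>"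
  define bad where "bad = (\<lambda>W. {a. \<exists>k l. k \<le> l \<and> l + Max W \<le> n \<and> b + 2 * c < \<bar>window_sum W k l a\<bar>})"
  have n: "2 \<le> n" using assms by simp
  have "n \<le> n choose (r - 1)" using assms by (intro le_choose) auto
  then have C: "real n \<le> C" by (simp add: C_def)
  then have C1: "1 < C" using n by simp
  then have lnC: "0 < ln C" by simp
  have K: "0 < K"
  proof (rule ccontr)
    assume "\<not> 0 < K"
    moreover have "0 < 32 * (3 + \<epsilon>) / \<epsilon>\<^sup>2" using assms(1) by (intro divide_pos_pos) auto
    ultimately show False using assms(5) by simp
  qed
  have \<Lambda>: "\<Lambda>\<^sup>2 = 2 * real n * ln C" "0 \<le> \<Lambda>"
    using lnC by (auto simp: \<Lambda>_def)
  have bc: "0 \<le> b" "0 \<le> c" "b + 2 * c = (1 + \<epsilon>) * \<Lambda>"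
    using assms(1) \<Lambda>(2) by (auto simp: b_def c_def field_simps)
  have exp_b: "exp (- b\<^sup>2 / (2 * real n)) \<le> C powr (- (1 + \<epsilon>))"
  proof -
    have "b\<^sup>2 / (2 * real n) = (1 + \<epsilon> / 2)\<^sup>2 * ln C"
      using n by (simp add: b_def power_mult_distrib \<Lambda>(1))
    also have "\<dots> \<ge> (1 + \<epsilon>) * ln C"
      using lnC by (intro mult_right_mono) (auto simp: power2_eq_square field_simps)
    finally show ?thesis using C1 by (simp add: powr_def algebra_simps)
  qed
  have exp_c: "exp (- c\<^sup>2 * real K / (4 * real n)) \<le> C powr (- (3 + \<epsilon>))"
  proof -
    have "c\<^sup>2 * real K / (4 * real n) = \<epsilon>\<^sup>2 * real K / 32 * ln C"
      using n by (simp add: c_def power_mult_distrib power_divide \<Lambda>(1) field_simps)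
    also have "\<dots> \<ge> (3 + \<epsilon>) * ln C"
      using lnC assms(1,5) by (intro mult_right_mono) (auto simp: field_simps)
    finally show ?thesis using C1 by (simp add: powr_def algebra_simps)
  qed
  have prob_bad: "P (bad W) \<le> (2 * (real K + 1)\<^sup>2 + 8) * C powr (- (1 + \<epsilon>))" if "W \<in> lag_sets n r" for W
  proof -
    have "real n + 1 \<le> 2 * C" using C C1 by linarith
    then have "(real n + 1)\<^sup>2 \<le> (2 * C)\<^sup>2" by (intro power_mono) auto
    also have "\<dots> = 4 * C powr 2" using C1 by (simp add: power_mult_distrib powr_numeral)
    finally have "(real n + 1)\<^sup>2 * exp (- c\<^sup>2 * real K / (4 * real n))
        \<le> (4 * C powr 2) * C powr (- (3 + \<epsilon>))"
      using exp_c by (intro mult_mono) auto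
    also have "\<dots> = 4 * C powr (- (1 + \<epsilon>))" by (simp flip: powr_add)
    finally have c: "(real n + 1)\<^sup>2 * exp (- c\<^sup>2 * real K / (4 * real n)) \<le> 4 * C powr (- (1 + \<epsilon>))" .
    have "(real K + 1)\<^sup>2 * exp (- b\<^sup>2 / (2 * real n)) \<le> (real K + 1)\<^sup>2 * C powr (- (1 + \<epsilon>))"
      by (intro mult_left_mono exp_b) simp
    with c prob_exists_window_sum_gt[OF lag_setsD[OF that] K \<open>K \<le> n\<close> bc(1,2)]
    show ?thesis unfolding P_def bad_def distrib_right by linarith
  qed
  have "{a. (1 + \<epsilon>) * \<Lambda> < correlation_measure n r a} \<subseteq> (\<Union>W\<in>lag_sets n r. bad W)"
  proof (rule subsetI, rule ccontr)
    fix a assume "a \<in> {a. (1 + \<epsilon>) * \<Lambda> < correlation_measure n r a}"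
      and *: "a \<notin> (\<Union>W\<in>lag_sets n r. bad W)"
    moreover have "correlation_measure n r a \<le> (1 + \<epsilon>) * \<Lambda>"
      using * by (intro correlation_measure_le assms) (force simp: bad_def bc(3))
    ultimately show False by simp
  qed
  then have "P {a. (1 + \<epsilon>) * \<Lambda> < correlation_measure n r a} \<le> P (\<Union>W\<in>lag_sets n r. bad W)"
    unfolding P_def by (intro measure_pmf.finite_measure_mono) auto
  also have "\<dots> \<le> (\<Sum>W\<in>lag_sets n r. P (bad W))"
    unfolding P_def by (intro measure_UNION_le finite_lag_sets) auto
  also have "\<dots> \<le> card (lag_sets n r) * ((2 * (real K + 1)\<^sup>2 + 8) * C powr (- (1 + \<epsilon>)))"
    by (intro sum_bounded_above prob_bad)
  also have "\<dots> \<le> C * ((2 * (real K + 1)\<^sup>2 + 8) * C powr (- (1 + \<epsilon>)))"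
    using card_lag_sets[of n r] by (intro mult_right_mono) (auto simp: C_def)
  also have "\<dots> = (2 * (real K + 1)\<^sup>2 + 8) * (C powr 1 * C powr (- (1 + \<epsilon>)))"
    using C1 by simp
  also have "\<dots> = (2 * (real K + 1)\<^sup>2 + 8) * C powr (- \<epsilon>)"
    by (simp only: powr_add[symmetric]) simp
  finally show ?thesis by (simp only: P_def \<Lambda>_def C_def)
qed

theorem theorem1p2:
  fixes \<epsilon> :: real
  assumes "\<epsilon> > 0"
  shows "(\<lambda>n. measure_pmf.prob (pmf_of_set (sign_seqs n))
            {a. \<forall>r. 2 \<le> r \<and> r \<le> n \<longrightarrow>
                 correlation_measure n r a
                   \<le> (1 + \<epsilon>) * sqrt (2 * real n * ln (real (n choose (r - 1))))})
         \<longlonglongrightarrow> 1"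
proof -
  define P where "P = (\<lambda>n. measure_pmf.prob (pmf_of_set (sign_seqs n)))"
  define good where "good = (\<lambda>n. {a. \<forall>r. 2 \<le> r \<and> r \<le> n \<longrightarrow> correlation_measure n r a
    \<le> (1 + \<epsilon>) * sqrt (2 * real n * ln (real (n choose (r - 1))))})"
  define bad where "bad = (\<lambda>n r. {a. (1 + \<epsilon>) * sqrt (2 * real n * ln (real (n choose (r - 1))))
    < correlation_measure n r a})"
  obtain K where K: "32 * (3 + \<epsilon>) / \<epsilon>\<^sup>2 \<le> real K"
    using real_arch_simple by blast
  define B where "B = 2 * (real K + 1)\<^sup>2 + 8"
  have "1 - B * (\<Sum>k\<in>{1..<n}. real (n choose k) powr (- \<epsilon>)) \<le> P n (good n)" if "K \<le> n" for n
  proof -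
    have "- good n = (\<Union>r\<in>{2..n}. bad n r)"
      by (auto simp: good_def bad_def not_le)
    then have "1 - P n (good n) = P n (\<Union>r\<in>{2..n}. bad n r)"
      unfolding P_def using measure_pmf.prob_compl[of "good n" "pmf_of_set (sign_seqs n)"]
      by (simp add: Compl_eq_Diff_UNIV)
    also have "\<dots> \<le> (\<Sum>r\<in>{2..n}. P n (bad n r))"
      unfolding P_def by (intro measure_UNION_le) auto
    also have "\<dots> \<le> (\<Sum>r\<in>{2..n}. B * real (n choose (r - 1)) powr (- \<epsilon>))"
      unfolding P_def bad_def B_def using assms that K
      by (intro sum_mono prob_correlation_measure_gt) auto
    also have "\<dots> = (\<Sum>k\<in>{1..<n}. B * real (n choose k) powr (- \<epsilon>))"
      by (rule sum.reindex_bij_witness[of _ Suc "\<lambda>r. r - 1"]) auto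
    finally show ?thesis by (simp add: sum_distrib_left)
  qed
  then have "\<forall>\<^sub>F n in sequentially. 1 - B * (\<Sum>k\<in>{1..<n}. real (n choose k) powr (- \<epsilon>)) \<le> P n (good n)"
    by (rule eventually_sequentiallyI)
  moreover have "\<forall>\<^sub>F n in sequentially. P n (good n) \<le> 1"
    by (simp add: P_def)
  moreover have "(\<lambda>n. 1 - B * (\<Sum>k\<in>{1..<n}. real (n choose k) powr (- \<epsilon>))) \<longlonglongrightarrow> 1 - B * 0"
    by (intro tendsto_diff tendsto_mult tendsto_const sum_choose_powr_tendsto_0 assms)
  then have "(\<lambda>n. 1 - B * (\<Sum>k\<in>{1..<n}. real (n choose k) powr (- \<epsilon>))) \<longlonglongrightarrow> 1"
    by simp
  ultimately have "(\<lambda>n. P n (good n)) \<longlonglongrightarrow> 1"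
    by (rule tendsto_sandwich[OF _ _ _ tendsto_const])
  then show ?thesis by (simp only: P_def good_def)
qed

end
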